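(* Suppose that $f(x)=g(F(x))$ for $x\in\mathbb{R}^n$, where $g:\mathbb{R}^m\to\overline{\mathbb{R}}$ is proper lsc and $F:\mathbb{R}^n\to\mathbb{R}^m$ is a smooth map. Let $\bar{x}\in\operatorname{dom}\partial f$ and let $\varepsilon_0>0$. Assume that $g$ has the generalized concave KL property at $F(\bar{x})$ with respect to $U_0=\mathbb{B}(F(\bar{x});\varepsilon_0)$, $\eta>0$ and $\varphi\in\Phi_\eta$. If the Jacobian $\nabla F(\bar{x})$ has rank $m$, then there exist $\alpha>0$ and $\varepsilon_1>0$ such that for every $x\in\mathbb{B}(\bar{x};\varepsilon_1)$, $$\|y\|\leq\alpha\,\|(\nabla F(x))^*(y)\|,\qquad\forall y\in\mathbb{R}^m\setminus\{0\}.$$ Furthermore, there exists $\varepsilon\in(0,\min\{\varepsilon_0,\varepsilon_1\}]$ such that $f$ has the generalized concave KL property at $\bar{x}$ with respect to $U_1=\mathbb{B}(\bar{x};\varepsilon)$, $\eta$ and $\alpha\cdot\varphi\in\Phi_\eta$.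
   Context: Notation. $\overline{\mathbb{R}}=(-\infty,\infty]$, $\mathbb{R}_+=[0,\infty)$, $\|\cdot\|$ is the Euclidean norm, $\mathbb{B}(\bar{x};r)$ is the open ball of center $\bar x$ and radius $r$. $\operatorname{dist}(x,K)=\inf\{\|x-y\|:y\in K\}$, with $\operatorname{dist}(x,\varnothing)=\infty$. For $f:\mathbb{R}^n\to\overline{\mathbb{R}}$, $[r_1<f<r_2]=\{x\in\mathbb{R}^n:r_1<f(x)<r_2\}$. "lsc" means lower semicontinuous. "Smooth" means continuously differentiable. $(\nabla F(x))^*$ is the adjoint (transpose) of the Jacobian $\nabla F(x):\mathbb{R}^n\to\mathbb{R}^m$. Left derivative. $\varphi'_-(t)=\lim_{s\to t^-}\frac{\varphi(s)-\varphi(t)}{s-t}$. Subdifferential. Let $f:\mathbb{R}^n\to\overline{\mathbb{R}}$ be proper. For $\bar x\in\operatorname{dom}f$, $v$ is a Fréchet subgradient of $f$ at $\bar x$, $v\in\hat\partial f(\bar x)$, if $f(x)\ge f(\bar x)+\langle v,x-\bar x\rangle+o(\|x-\bar x\|)$ for every $x\in\operatorname{dom}f$. The limiting subdifferential is $\partial f(\bar x)=\{u:\exists x_k\to\bar x \text{ with } f(x_k)\to f(\bar x),\ \exists u_k\in\hat\partial f(x_k),\ u_k\to u\}$. $\operatorname{dom}\partial f=\{x:\partial f(x)\neq\varnothing\}$. The class $\Phi_\eta$. For $\eta\in(0,\infty]$, $\Phi_\eta$ is the class of functions $\varphi:[0,\eta)\to\mathbb{R}_+$ that are right-continuous at $0$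 with $\varphi(0)=0$ and strictly increasing on $[0,\eta)$. Generalized concave KL (Kurdyka-Łojasiewicz) property. Let $f:\mathbb{R}^n\to\overline{\mathbb{R}}$ be proper lsc and $\bar x\in\operatorname{dom}\partial f$. Given a neighborhood $U$ of $\bar x$, $\eta\in(0,\infty]$ and a concave $\varphi\in\Phi_\eta$, $f$ has the generalized concave KL property at $\bar x$ with respect to $U$, $\eta$ and $\varphi$ if for all $x\in U\cap[0<f-f(\bar x)<\eta]$, $$\varphi'_-\big(f(x)-f(\bar x)\big)\cdot\operatorname{dist}\big(0,\partial f(x)\big)\geq 1.$$ In particular, saying that the property holds with respect to $\varphi$ includes that $\varphi$ is concave and $\varphi\in\Phi_\eta$. The same definition applies to functions on $\mathbb{R}^m$. *)

theory Defs
  imports "HOL-Analysis.Analysis" "HOL-Library.Landau_Symbols"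
begin

text \<open>
  Functions with values in the extended half-line without minus infinity are modelled as
  \<open>ereal\<close>-valued functions; the exclusion of the value \<open>-\<infinity>\<close> is part of \<open>proper\<close>.
\<close>

definition proper :: "('a \<Rightarrow> ereal) \<Rightarrow> bool" where
  "proper f \<longleftrightarrow> (\<forall>x. f x \<noteq> -\<infinity>) \<and> (\<exists>x. f x \<noteq> \<infinity>)"

definition edom :: "('a \<Rightarrow> ereal) \<Rightarrow> 'a set" where
  "edom f = {x. f x < \<infinity>}"

definition lsc :: "('a::topological_space \<Rightarrow> ereal) \<Rightarrow> bool" where
  "lsc f \<longleftrightarrow> (\<forall>x. f x \<le> Liminf (at x) f)"

definition smooth_map :: "(real ^ 'n \<Rightarrow> real ^ 'm) \<Rightarrow> bool" where
  "smooth_map F \<longleftrightarrow>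
     (\<forall>x. F differentiable (at x)) \<and> continuous_on UNIV (\<lambda>x. jacobian F (at x))"

text \<open>
  Subgradients exist only at points of the domain, so both subdifferentials are empty elsewhere.
  In the Frechet case the term \<open>o(\<parallel>x - xbar\<parallel>)\<close> is the function \<open>r\<close>; at \<open>x = xbar\<close> the
  inequality only asks for \<open>r xbar \<le> 0\<close>.
\<close>

definition frechet_subdiff :: "('a::real_inner \<Rightarrow> ereal) \<Rightarrow> 'a \<Rightarrow> 'a set" where
  "frechet_subdiff f xbar =
     {v. xbar \<in> edom f \<and>
         (\<exists>r :: 'a \<Rightarrow> real. r \<in> o[at xbar](\<lambda>x. norm (x - xbar)) \<and>
            (\<forall>x \<in> edom f. f x \<ge> f xbar + ereal (v \<bullet> (x - xbar) + r x)))}"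

definition limiting_subdiff :: "('a::real_inner \<Rightarrow> ereal) \<Rightarrow> 'a \<Rightarrow> 'a set" where
  "limiting_subdiff f xbar =
     {u. xbar \<in> edom f \<and>
         (\<exists>(x :: nat \<Rightarrow> 'a) (w :: nat \<Rightarrow> 'a).
            x \<longlonglongrightarrow> xbar \<and> (\<lambda>k. f (x k)) \<longlonglongrightarrow> f xbar \<and>
            (\<forall>k. w k \<in> frechet_subdiff f (x k)) \<and> w \<longlonglongrightarrow> u)}"

definition dom_subdiff :: "('a::real_inner \<Rightarrow> ereal) \<Rightarrow> 'a set" where
  "dom_subdiff f = {x. limiting_subdiff f x \<noteq> {}}"

text \<open>
  Unlike \<open>infdist\<close>, which is 0 for the empty set, this distance is \<open>\<infinity>\<close> there.
\<close>

definition edist_set :: "'a::metric_space \<Rightarrow> 'a set \<Rightarrow> ereal" where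
  "edist_set x K = (INF y\<in>K. ereal (dist x y))"

definition left_derivative :: "(real \<Rightarrow> real) \<Rightarrow> real \<Rightarrow> real" where
  "left_derivative \<phi> t = Lim (at_left t) (\<lambda>s. (\<phi> s - \<phi> t) / (s - t))"

text \<open>
  The interval \<open>[0, \<eta>)\<close> for \<open>\<eta> \<in> (0, \<infinity>]\<close>. Functions on it are represented by functions on
  \<open>real\<close> whose values outside the interval are irrelevant.
\<close>

definition ivl :: "ereal \<Rightarrow> real set" where
  "ivl \<eta> = {t. 0 \<le> t \<and> ereal t < \<eta>}"

definition Phi :: "ereal \<Rightarrow> (real \<Rightarrow> real) set" where
  "Phi \<eta> = {\<phi>. (\<forall>t \<in> ivl \<eta>. \<phi> t \<ge> 0) \<and> continuous (at_right 0) \<phi> \<and> \<phi> 0 = 0 \<and>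
               strict_mono_on (ivl \<eta>) \<phi>}"

text \<open>
  The standing requirements on \<open>f\<close>, \<open>xbar\<close>, \<open>U\<close>, \<open>\<eta>\<close> and \<open>\<phi>\<close> are part of the property.
  For \<open>x\<close> in the relevant set both \<open>f x\<close> and \<open>f xbar\<close> are finite, so \<open>real_of_ereal\<close> loses nothing.
  The left derivative of a concave strictly increasing \<open>\<phi>\<close> exists and is positive there, so the
  product with an infinite distance is \<open>\<infinity>\<close>.
\<close>

definition gen_concave_KL ::
  "('a::real_inner \<Rightarrow> ereal) \<Rightarrow> 'a \<Rightarrow> 'a set \<Rightarrow> ereal \<Rightarrow> (real \<Rightarrow> real) \<Rightarrow> bool" where
  "gen_concave_KL f xbar U \<eta> \<phi> \<longleftrightarrow>
     proper f \<and> lsc f \<and> xbar \<in> dom_subdiff f \<and> xbar \<in> interior U \<and>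
     0 < \<eta> \<and> \<phi> \<in> Phi \<eta> \<and> concave_on (ivl \<eta>) \<phi> \<and>
     (\<forall>x \<in> U \<inter> {x. 0 < f x - f xbar \<and> f x - f xbar < \<eta>}.
        ereal (left_derivative \<phi> (real_of_ereal (f x - f xbar)))
          * edist_set 0 (limiting_subdiff f x) \<ge> 1)"

end

theory Submission
  imports Defs
begin

text \<open>
  Wherever the Jacobian \<open>J\<close> of \<open>F\<close> is onto, subgradients of \<open>g \<circ> F\<close> come from subgradients of
  \<open>g\<close>: every Frechet subgradient \<open>u\<close> of \<open>g \<circ> F\<close> at \<open>x\<close> has the form \<open>J\<^sup>T v\<close> with \<open>v\<close> a Frechet
  subgradient of \<open>g\<close> at \<open>F x\<close> (\<open>frechet_subdiff_chain_rule\<close>). To see this, choose a local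
  diffeomorphism \<open>\<Theta>\<close> of the source space, tangent to the identity, that straightens \<open>F\<close> into the
  affine map \<open>w \<mapsto> F x + J w\<close> (\<open>local_linearization\<close>). Frechet subgradients pull back along
  differentiable maps (\<open>frechet_subdiff_pullback\<close>), so \<open>u\<close> is also a subgradient at \<open>0\<close> of
  \<open>w \<mapsto> g (F x + J w)\<close>. Let \<open>A\<close> be a linear right inverse of \<open>J\<close>. Pulling \<open>u\<close> back along \<open>A\<close>
  gives the subgradient \<open>v = A\<^sup>T u\<close> of \<open>g\<close>, and pulling it back along the projection \<open>id - A J\<close>
  onto the kernel of \<open>J\<close> gives a subgradient of a constant, that is \<open>0\<close>; hence
  \<open>u = J\<^sup>T A\<^sup>T u = J\<^sup>T v\<close>.

  Full rank at \<open>xbar\<close> makes \<open>J\<^sup>T\<close> bounded below, and by continuity of the Jacobian the same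
  bound, up to a factor, holds on a ball (\<open>transpose_bounded_below_near_full_rank\<close>). There
  \<open>\<parallel>v\<parallel> \<le> \<alpha> \<parallel>u\<parallel>\<close>. Since this bound keeps the \<open>v\<close>'s bounded along any sequence of \<open>u\<close>'s that
  converges, it passes to limiting subgradients (\<open>limiting_subdiff_norm_bound\<close>), so that
  \<open>dist(0, \<partial>g(F x)) \<le> \<alpha> dist(0, \<partial>f x)\<close>. Multiplying by the left derivative of \<open>\<phi>\<close>, which is
  positive because the KL inequality for \<open>g\<close> holds, moves \<open>\<alpha>\<close> into \<open>\<alpha> \<phi>\<close> and gives the KL
  inequality for \<open>f\<close>.
\<close>

section \<open>Frechet subgradients\<close>

text \<open>
  The epsilon form of the definition. It is local, and it replaces the choice of a remainder
  function by inequalities that can be combined with other eventual estimates.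
\<close>

lemma frechet_subdiff_iff:
  fixes f :: "'a::real_inner \<Rightarrow> ereal"
  assumes "\<And>x. f x \<noteq> -\<infinity>"
  shows "v \<in> frechet_subdiff f a \<longleftrightarrow>
    f a < \<infinity> \<and> (\<forall>c>0. \<forall>\<^sub>F x in nhds a. f a + ereal (v \<bullet> (x - a) - c * norm (x - a)) \<le> f x)"
    (is "_ \<longleftrightarrow> ?R")
proof
  assume "v \<in> frechet_subdiff f a"
  then obtain r where a: "f a < \<infinity>" and r: "r \<in> o[at a](\<lambda>x. norm (x - a))"
    and ge: "\<And>x. f x < \<infinity> \<Longrightarrow> f x \<ge> f a + ereal (v \<bullet> (x - a) + r x)"
    by (auto simp: frechet_subdiff_def edom_def)
  have "\<forall>\<^sub>F x in nhds a. f a + ereal (v \<bullet> (x - a) - c * norm (x - a)) \<le> f x" if "c > 0" for c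
  proof -
    have "\<forall>\<^sub>F x in at a. norm (r x) \<le> c * norm (norm (x - a))"
      using landau_o.smallD[OF r that] .
    then have "\<forall>\<^sub>F x in at a. f a + ereal (v \<bullet> (x - a) - c * norm (x - a)) \<le> f x"
    proof eventually_elim
      case (elim x)
      show ?case
      proof (cases "f x < \<infinity>")
        case True
        have "f a + ereal (v \<bullet> (x - a) - c * norm (x - a)) \<le> f a + ereal (v \<bullet> (x - a) + r x)"
          using elim by (intro add_left_mono) auto
        then show ?thesis using ge[OF True] by order
      qed auto
    qed
    then show ?thesis
      by (auto simp: eventually_nhds_conv_at)
  qed
  with a show ?R by blast
next
  assume R: ?R
  \<comment> \<open>On the domain, the negative part of the linearization error is the largest nonpositive
      remainder satisfying the global inequality; outside the domain nothing is
      asked of it and \<open>0\<close> is small enough.\<close>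
  define r where "r x = (if f x = \<infinity> then 0
      else min 0 (real_of_ereal (f x) - real_of_ereal (f a) - v \<bullet> (x - a)))" for x
  obtain fa where fa: "f a = ereal fa"
    using R assms[of a] by (cases "f a") auto
  have "r \<in> o[at a](\<lambda>x. norm (x - a))"
  proof (rule landau_o.smallI)
    fix c :: real assume "c > 0"
    with R have "\<forall>\<^sub>F x in at a. f a + ereal (v \<bullet> (x - a) - c * norm (x - a)) \<le> f x"
      by (auto simp: eventually_nhds_conv_at)
    then show "\<forall>\<^sub>F x in at a. norm (r x) \<le> c * norm (norm (x - a))"
    proof eventually_elim
      case (elim x)
      then show ?case using assms[of x] \<open>c > 0\<close>
        by (cases "f x") (auto simp: r_def fa min_def abs_if)
    qed
  qed
  moreover have "f x \<ge> f a + ereal (v \<bullet> (x - a) + r x)" if "f x < \<infinity>" for x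
    using that assms[of x] by (cases "f x") (auto simp: r_def fa min_def)
  ultimately show "v \<in> frechet_subdiff f a"
    using R by (auto simp: frechet_subdiff_def edom_def)
qed

text \<open>
  The easy inclusion of the chain rule, valid for any inner map differentiable at the point. Only
  a local identity between \<open>h\<close> and \<open>f \<circ> \<Theta>\<close> is asked for because the straightening map \<open>\<Theta>\<close>
  used below is meaningful near one point only.
\<close>

lemma frechet_subdiff_pullback:
  fixes f :: "'a::real_inner \<Rightarrow> ereal" and h :: "'b::real_inner \<Rightarrow> ereal"
  assumes f: "\<And>x. f x \<noteq> -\<infinity>" and h: "\<And>x. h x \<noteq> -\<infinity>"
    and eq: "\<forall>\<^sub>F w in nhds b. h w = f (\<Theta> w)"
    and der: "(\<Theta> has_derivative \<Theta>') (at b)"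
    and u: "u \<in> frechet_subdiff f (\<Theta> b)"
    and v: "\<And>w. v \<bullet> w = u \<bullet> \<Theta>' w"
  shows "v \<in> frechet_subdiff h b"
proof -
  have hb: "h b = f (\<Theta> b)"
    using eventually_nhds_x_imp_x[OF eq] .
  have cont: "filterlim \<Theta> (nhds (\<Theta> b)) (nhds b)"
    using has_derivative_continuous[OF der] by (simp add: continuous_at tendsto_at_iff_tendsto_nhds)
  obtain K where K: "K > 0" "\<And>w. norm (\<Theta>' w) \<le> norm w * K"
    using bounded_linear.pos_bounded[OF has_derivative_bounded_linear[OF der]] by blast
  have "\<forall>\<^sub>F w in nhds b. h b + ereal (v \<bullet> (w - b) - c * norm (w - b)) \<le> h w" if "c > 0" for c
  proof -
    \<comment> \<open>With accuracy \<open>e \<le> 1\<close> for both \<open>\<Theta>\<close> and \<open>f\<close>, the total error is at most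
        \<open>e \<parallel>u\<parallel> + e (K + 1)\<close> times the distance to \<open>b\<close>.\<close>
    define e where "e = min 1 (c / (norm u + K + 1))"
    have pos: "norm u + K + 1 > 0"
      using K(1) by (smt (verit) norm_ge_zero)
    have e: "e > 0" "e \<le> 1" and "e \<le> c / (norm u + K + 1)"
      using \<open>c > 0\<close> pos by (auto simp: e_def)
    then have ec: "e * (norm u + K + 1) \<le> c"
      using pos by (simp add: pos_le_divide_eq)
    have "\<forall>\<^sub>F w in nhds b. norm (\<Theta> w - \<Theta> b - \<Theta>' (w - b)) \<le> e * norm (w - b)"
      using der e(1) unfolding has_derivative_at_alt eventually_nhds_metric dist_norm by blast
    moreover have "\<forall>\<^sub>F x in nhds (\<Theta> b). f (\<Theta> b) + ereal (u \<bullet> (x - \<Theta> b) - e * norm (x - \<Theta> b)) \<le> f x"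
      using u e(1) by (simp add: frechet_subdiff_iff[OF f])
    then have "\<forall>\<^sub>F w in nhds b. f (\<Theta> b) + ereal (u \<bullet> (\<Theta> w - \<Theta> b) - e * norm (\<Theta> w - \<Theta> b)) \<le> f (\<Theta> w)"
      using cont by (rule eventually_compose_filterlim)
    ultimately show ?thesis using eq
    proof eventually_elim
      case (elim w)
      let ?d = "norm (w - b)" and ?q = "\<Theta> w - \<Theta> b - \<Theta>' (w - b)"
      have "u \<bullet> (\<Theta> w - \<Theta> b) = v \<bullet> (w - b) + u \<bullet> ?q"
        unfolding v[of "w - b"] by (simp add: inner_diff_right)
      moreover have "\<bar>u \<bullet> ?q\<bar> \<le> norm u * (e * ?d)"
        using Cauchy_Schwarz_ineq2[of u ?q] elim(1) mult_left_mono[OF elim(1), of "norm u"] by simp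
      moreover have "norm (\<Theta> w - \<Theta> b) \<le> norm (\<Theta>' (w - b)) + norm ?q"
        using norm_triangle_ineq[of "\<Theta>' (w - b)" ?q] by simp
      then have "norm (\<Theta> w - \<Theta> b) \<le> (K + 1) * ?d"
        using K(2)[of "w - b"] elim(1) mult_right_mono[OF e(2), of ?d]
        by (simp add: algebra_simps)
      then have "e * norm (\<Theta> w - \<Theta> b) \<le> e * ((K + 1) * ?d)"
        using e(1) by simp
      moreover have "e * (norm u + K + 1) * ?d \<le> c * ?d"
        using ec by (intro mult_right_mono) auto
      ultimately have "v \<bullet> (w - b) - c * ?d \<le> u \<bullet> (\<Theta> w - \<Theta> b) - e * norm (\<Theta> w - \<Theta> b)"
        by (simp add: algebra_simps)
      then have "h b + ereal (v \<bullet> (w - b) - c * ?d)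
          \<le> f (\<Theta> b) + ereal (u \<bullet> (\<Theta> w - \<Theta> b) - e * norm (\<Theta> w - \<Theta> b))"
        unfolding hb by (intro add_left_mono) auto
      then show ?case using elim by order
    qed
  qed
  moreover have "h b < \<infinity>"
    using u hb by (simp add: frechet_subdiff_iff[OF f])
  ultimately show ?thesis
    by (simp add: frechet_subdiff_iff[OF h])
qed

text \<open>Moving from \<open>a\<close> in the direction \<open>v\<close> would otherwise force the constant to increase.\<close>

lemma frechet_subdiff_const:
  assumes "k \<noteq> -\<infinity>" "v \<in> frechet_subdiff (\<lambda>_. k) a"
  shows "v = 0"
proof (rule ccontr)
  assume "v \<noteq> 0"
  then have v: "norm v > 0" by simp
  from assms have k: "k < \<infinity>"
    and "\<forall>c>0. \<forall>\<^sub>F x in nhds a. k + ereal (v \<bullet> (x - a) - c * norm (x - a)) \<le> k"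
    by (auto simp: frechet_subdiff_iff)
  then have "\<forall>\<^sub>F x in nhds a. k + ereal (v \<bullet> (x - a) - norm v / 2 * norm (x - a)) \<le> k"
    using v half_gt_zero by blast
  moreover have "filterlim (\<lambda>t::real. a + t *\<^sub>R v) (nhds a) (at_right 0)"
    by (auto intro!: tendsto_eq_intros)
  ultimately have "\<forall>\<^sub>F t in at_right 0. k + ereal (v \<bullet> (a + t *\<^sub>R v - a) - norm v / 2 * norm (a + t *\<^sub>R v - a)) \<le> k"
    by (rule eventually_compose_filterlim)
  moreover have "\<forall>\<^sub>F t in at_right 0. (0::real) < t"
    by (simp add: eventually_at_right_less)
  ultimately have "\<forall>\<^sub>F t in at_right (0::real). False"
  proof eventually_elim
    case (elim t)
    obtain k' where "k = ereal k'" using assms(1) k by (cases k) auto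
    then have "t * (norm v)\<^sup>2 \<le> t * (norm v)\<^sup>2 / 2"
      using elim(1) abs_of_pos[OF elim(2)]
      by (simp add: power2_eq_square mult.assoc mult.left_commute[of _ t] flip: power2_norm_eq_inner)
    moreover have "t * (norm v)\<^sup>2 > 0"
      using v elim(2) by simp
    ultimately show False by linarith
  qed
  then show False by simp
qed

section \<open>Straightening a submersion\<close>

text \<open>
  The submersion theorem with the change of variables on the source side. The map
  \<open>\<Psi> y = A (F y - F x - J (y - x)) + (y - x)\<close> has derivative \<open>id\<close> at \<open>x\<close>, so it is locally
  invertible; since \<open>J A = id\<close>, it satisfies \<open>J (\<Psi> y) = F y - F x\<close>, and its inverse is the
  wanted \<open>\<Theta>\<close>.
\<close>

lemma local_linearization:
  fixes F :: "'a::euclidean_space \<Rightarrow> 'b::euclidean_space"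
  assumes U: "open U" "x \<in> U"
    and der: "\<And>y. y \<in> U \<Longrightarrow> (F has_derivative blinfun_apply (DF y)) (at y)"
    and cont: "continuous_on U DF"
    and A: "\<And>y. DF x (blinfun_apply A y) = y"
  obtains \<Theta> where "\<Theta> 0 = x" "(\<Theta> has_derivative (\<lambda>w. w)) (at 0)"
    "\<forall>\<^sub>F w in nhds 0. F (\<Theta> w) = F x + DF x w"
proof -
  define \<Psi> where "\<Psi> y = A (F y - F x - DF x (y - x)) + (y - x)" for y
  define D where "D y = (A o\<^sub>L (DF y - DF x)) + id_blinfun" for y
  have Dx: "D x = id_blinfun"
    by (simp add: D_def)
  have \<Psi>x: "\<Psi> x = 0" by (simp add: \<Psi>_def)
  have "(\<Psi> has_derivative D y) (at y)" if "y \<in> U" for y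
    unfolding \<Psi>_def D_def
    by (rule derivative_eq_intros der that refl | simp add: blinfun.bilinear_simps fun_eq_iff)+
  moreover have "continuous_on U D"
    unfolding D_def by (intro continuous_intros cont)
  moreover have "id_blinfun o\<^sub>L D x = id_blinfun"
    by (simp add: Dx blinfun_eqI)
  ultimately obtain U' V \<Theta> \<Theta>' where UV: "x \<in> U'" "open V" "\<Psi> x \<in> V" "homeomorphism U' V \<Psi> \<Theta>"
    and d: "\<And>w. w \<in> V \<Longrightarrow> (\<Theta> has_derivative (\<Theta>' w)) (at w)"
      "\<And>w. w \<in> V \<Longrightarrow> \<Theta>' w = inv (blinfun_apply (D (\<Theta> w)))"
    using inverse_function_theorem[OF U(1) _ _ U(2)] by metis
  have \<Theta>0: "\<Theta> 0 = x"
    using UV \<Psi>x by (auto simp: homeomorphism_def)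
  have "\<Theta>' 0 = (\<lambda>w. w)"
    using d(2)[of 0] UV(3) by (simp add: \<Psi>x \<Theta>0 Dx id_def[symmetric] id_blinfun.rep_eq[unfolded id_def[symmetric]])
  then have "(\<Theta> has_derivative (\<lambda>w. w)) (at 0)"
    using d(1)[of 0] UV(3) by (simp add: \<Psi>x)
  moreover have "F (\<Theta> w) = F x + DF x w" if "w \<in> V" for w
  proof -
    have "\<Psi> (\<Theta> w) = w"
      using that UV(4) by (auto simp: homeomorphism_def)
    moreover have "DF x (\<Psi> (\<Theta> w)) = F (\<Theta> w) - F x"
      by (simp add: \<Psi>_def A blinfun.bilinear_simps)
    ultimately show ?thesis by simp
  qed
  then have "\<forall>\<^sub>F w in nhds 0. F (\<Theta> w) = F x + DF x w"
    using UV(2,3) \<Psi>x by (auto simp: eventually_nhds)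
  ultimately show thesis using that \<Theta>0 by blast
qed

text \<open>
  Straightening turns the composition into \<open>w \<mapsto> g (F x + J w)\<close> with the same subgradient \<open>u\<close>.
  Restricting it to the range of a right inverse \<open>A\<close> of \<open>J\<close> recovers \<open>g\<close>; restricting it to
  the kernel of \<open>J\<close>, where it is constant, shows that \<open>u\<close> is orthogonal to the kernel.
\<close>

lemma frechet_subdiff_chain_rule:
  fixes F :: "'a::euclidean_space \<Rightarrow> 'b::euclidean_space" and g :: "'b \<Rightarrow> ereal"
  assumes g: "\<And>y. g y \<noteq> -\<infinity>"
    and U: "open U" "x \<in> U"
    and der: "\<And>y. y \<in> U \<Longrightarrow> (F has_derivative blinfun_apply (DF y)) (at y)"
    and cont: "continuous_on U DF"
    and surj: "surj (blinfun_apply (DF x))"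
    and u: "u \<in> frechet_subdiff (\<lambda>y. g (F y)) x"
  shows "\<exists>v \<in> frechet_subdiff g (F x). \<forall>z. u \<bullet> z = v \<bullet> DF x z"
proof -
  interpret J: bounded_linear "blinfun_apply (DF x)" by (rule blinfun.bounded_linear_right)
  obtain A0 where A0: "linear A0" "blinfun_apply (DF x) \<circ> A0 = id"
    using linear_surjective_right_inverse[OF J.linear_axioms surj] by blast
  define A where "A = Blinfun A0"
  have A: "DF x (blinfun_apply A y) = y" for y
    using A0 by (simp add: A_def bounded_linear_Blinfun_apply linear_conv_bounded_linear[symmetric]
        o_def id_def fun_eq_iff)
  obtain \<Theta> where \<Theta>0: "\<Theta> 0 = x" and \<Theta>d: "(\<Theta> has_derivative (\<lambda>w. w)) (at 0)"
    and lin: "\<forall>\<^sub>F w in nhds 0. F (\<Theta> w) = F x + DF x w"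
    using local_linearization[OF U der cont A] by blast
  let ?h = "\<lambda>w. g (F x + DF x w)"
  have uh: "u \<in> frechet_subdiff ?h 0"
  proof (rule frechet_subdiff_pullback[where f = "\<lambda>y. g (F y)", OF _ _ _ \<Theta>d])
    show "\<forall>\<^sub>F w in nhds 0. ?h w = g (F (\<Theta> w))"
      using lin by eventually_elim simp
  qed (use g u \<Theta>0 in auto)
  define v where "v = adjoint A u"
  have v: "v \<bullet> y = u \<bullet> A y" for y
    unfolding v_def using adjoint_works[OF bounded_linear.linear[OF blinfun.bounded_linear_right], of y A u]
    by (simp add: inner_commute)
  have "v \<in> frechet_subdiff g (F x)"
    by (rule frechet_subdiff_pullback[where f = ?h and \<Theta> = "\<lambda>y. A (y - F x)" and \<Theta>' = A])
      (use g uh in \<open>auto intro!: derivative_eq_intros simp: A v\<close>)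
  moreover have "u \<bullet> z = v \<bullet> DF x z" for z
  proof -
    \<comment> \<open>The projection onto the kernel of \<open>J\<close> along the range of \<open>A\<close>.\<close>
    let ?P = "\<lambda>z. z - A (DF x z)"
    have lP: "bounded_linear ?P"
      by (intro bounded_linear_sub bounded_linear_ident
          bounded_linear_compose[OF blinfun.bounded_linear_right] blinfun.bounded_linear_right)
    have "adjoint ?P u \<in> frechet_subdiff (\<lambda>_. g (F x)) 0"
    proof (rule frechet_subdiff_pullback[where f = ?h and \<Theta> = ?P and \<Theta>' = ?P])
      show "(?P has_derivative ?P) (at 0)"
        using lP by (rule bounded_linear_imp_has_derivative)
      show "adjoint ?P u \<bullet> w = u \<bullet> ?P w" for w
        using adjoint_works[OF bounded_linear.linear[OF lP], of w u] by (simp add: inner_commute)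
    qed (use g uh in \<open>auto simp: A blinfun.bilinear_simps\<close>)
    then have "adjoint ?P u = 0"
      using frechet_subdiff_const g by blast
    then have "u \<bullet> ?P z = 0"
      using adjoint_works[OF bounded_linear.linear[OF lP], of z u] by (simp add: inner_commute)
    then show ?thesis by (simp add: v inner_diff_right)
  qed
  ultimately show ?thesis by blast
qed

section \<open>Limiting subgradients and their distance from zero\<close>

text \<open>
  The bound makes the subgradients of \<open>g\<close> belonging to a convergent sequence of subgradients of
  \<open>g \<circ> F\<close> bounded, so a subsequence of them converges, and its limit is a limiting subgradient.
\<close>

lemma limiting_subdiff_norm_bound:
  fixes F :: "'a::real_inner \<Rightarrow> 'b::euclidean_space" and g :: "'b \<Rightarrow> ereal"
  assumes U: "open U" "x \<in> U" and F: "isCont F x" and "\<alpha> \<ge> 0"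
    and bound: "\<And>y w. y \<in> U \<Longrightarrow> w \<in> frechet_subdiff (\<lambda>y. g (F y)) y \<Longrightarrow>
      \<exists>v \<in> frechet_subdiff g (F y). norm v \<le> \<alpha> * norm w"
    and u: "u \<in> limiting_subdiff (\<lambda>y. g (F y)) x"
  shows "\<exists>v \<in> limiting_subdiff g (F x). norm v \<le> \<alpha> * norm u"
proof -
  obtain X W where xe: "g (F x) < \<infinity>" and X: "X \<longlonglongrightarrow> x" and gX: "(\<lambda>k. g (F (X k))) \<longlonglongrightarrow> g (F x)"
    and W: "\<And>k. W k \<in> frechet_subdiff (\<lambda>y. g (F y)) (X k)" "W \<longlonglongrightarrow> u"
    using u by (auto simp: limiting_subdiff_def edom_def)
  \<comment> \<open>The bound is available on \<open>U\<close> only; the sequence is shifted by \<open>N\<close> so as to lie in it.\<close>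
  obtain N where N: "\<And>k. k \<ge> N \<Longrightarrow> X k \<in> U"
    using topological_tendstoD[OF X U] by (auto simp: eventually_sequentially)
  have "\<forall>k. \<exists>v \<in> frechet_subdiff g (F (X (k + N))). norm v \<le> \<alpha> * norm (W (k + N))"
    using bound N W(1) by simp
  then obtain V where V: "\<And>k. V k \<in> frechet_subdiff g (F (X (k + N)))"
    and le: "\<And>k. norm (V k) \<le> \<alpha> * norm (W (k + N))"
    by metis
  have lim: "(\<lambda>k. \<alpha> * norm (W (k + N))) \<longlonglongrightarrow> \<alpha> * norm u"
    by (intro tendsto_intros LIMSEQ_ignore_initial_segment W)
  from convergent_imp_bounded[OF lim]
  obtain C where C: "\<And>k. \<bar>\<alpha> * norm (W (k + N))\<bar> \<le> C"
    by (auto simp: bounded_iff)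
  have "norm (V k) \<le> C" for k
    using le[of k] C[of k] by linarith
  then have "bounded (range V)"
    by (auto simp: bounded_iff)
  then obtain v s where s: "strict_mono (s :: nat \<Rightarrow> nat)" and v: "(V \<circ> s) \<longlonglongrightarrow> v"
    using bounded_imp_convergent_subsequence by blast
  define Y where "Y k = X (s k + N)" for k
  have sN: "strict_mono (\<lambda>k. s k + N)"
    using s by (simp add: strict_mono_def)
  have "(\<lambda>k. F (Y k)) \<longlonglongrightarrow> F x"
    using isCont_tendsto_compose[OF F LIMSEQ_subseq_LIMSEQ[OF X sN]] by (simp add: Y_def o_def)
  moreover have "(\<lambda>k. g (F (Y k))) \<longlonglongrightarrow> g (F x)"
    using LIMSEQ_subseq_LIMSEQ[OF gX sN] by (simp add: Y_def o_def)
  moreover have "V (s k) \<in> frechet_subdiff g (F (Y k))" for k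
    using V by (simp add: Y_def)
  ultimately have "v \<in> limiting_subdiff g (F x)"
    using v xe unfolding limiting_subdiff_def edom_def o_def
    by (intro CollectI conjI exI[of _ "\<lambda>k. F (Y k)"] exI[of _ "\<lambda>k. V (s k)"]) auto
  moreover have "norm v \<le> \<alpha> * norm u"
  proof (rule LIMSEQ_le)
    show "(\<lambda>k. norm (V (s k))) \<longlonglongrightarrow> norm v"
      using tendsto_norm[OF v] by (simp add: o_def)
    show "(\<lambda>k. \<alpha> * norm (W (s k + N))) \<longlonglongrightarrow> \<alpha> * norm u"
      using LIMSEQ_subseq_LIMSEQ[OF lim s] by (simp add: o_def)
  qed (use le in auto)
  ultimately show ?thesis by blast
qed

text \<open>
  The case \<open>K = {}\<close>, in which the right-hand side is \<open>\<infinity>\<close>, is included; so is \<open>L = {}\<close>, which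
  forces \<open>K = {}\<close>.
\<close>

lemma edist_set_le_cmult:
  fixes K :: "'a::real_normed_vector set" and L :: "'b::real_normed_vector set"
  assumes "\<alpha> > 0" and "\<And>u. u \<in> K \<Longrightarrow> \<exists>v\<in>L. norm v \<le> \<alpha> * norm u"
  shows "edist_set 0 L \<le> ereal \<alpha> * edist_set 0 K"
proof -
  have "edist_set 0 L / ereal \<alpha> \<le> edist_set 0 K"
    unfolding edist_set_def[of _ K]
  proof (rule INF_greatest)
    fix u assume "u \<in> K"
    then obtain v where "v \<in> L" "norm v \<le> \<alpha> * norm u" using assms by blast
    then have "edist_set 0 L \<le> ereal (norm u) * ereal \<alpha>"
      unfolding edist_set_def by (intro INF_lower2[of v]) (auto simp: mult.commute)
    then show "edist_set 0 L / ereal \<alpha> \<le> ereal (dist 0 u)"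
      using \<open>\<alpha> > 0\<close> by (simp add: ereal_divide_le_pos mult.commute)
  qed
  then show ?thesis
    using \<open>\<alpha> > 0\<close> by (simp add: ereal_divide_le_pos)
qed

section \<open>Left derivatives of concave functions\<close>

text \<open>
  \<open>left_derivative\<close> is an unspecified number when the limit does not exist, so existence has to
  be known before a factor can be pulled out. By concavity the difference quotients at \<open>t\<close>
  decrease as \<open>s\<close> increases to \<open>t\<close>, and by monotonicity of \<open>\<phi>\<close> they are bounded below by \<open>0\<close>.
\<close>

lemma left_derivative_exists:
  fixes \<phi> :: "real \<Rightarrow> real"
  assumes conc: "concave_on (ivl \<eta>) \<phi>" and mono: "strict_mono_on (ivl \<eta>) \<phi>"
    and t: "t \<in> ivl \<eta>" "t > 0"
  shows "\<exists>l. ((\<lambda>s. (\<phi> s - \<phi> t) / (s - t)) \<longlongrightarrow> l) (at_left t)"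
proof -
  \<comment> \<open>The sign turns decreasing quotients into increasing ones, bounded above.\<close>
  let ?q = "\<lambda>s. - ((\<phi> s - \<phi> t) / (s - t))"
  have ivl: "s \<in> ivl \<eta>" if "0 < s" "s < t" for s
    using t that unfolding ivl_def by (auto intro: less_trans[of "ereal s" "ereal t"])
  have conv: "convex_on (ivl \<eta>) (\<lambda>s. - \<phi> s)"
    using conc by (simp add: concave_on_def)
  have "(?q \<longlongrightarrow> Sup (?q ` ({..<t} \<inter> {0<..}))) (at t within ({..<t} \<inter> {0<..}))"
  proof (rule Lim_left_bound[where K = 0])
    fix a b assume ab: "a \<in> {0<..}" "b \<in> {0<..}" "b < t" "a \<le> b"
    show "?q a \<le> ?q b"
    proof (cases "a = b")
      case False
      then have "(\<phi> b - \<phi> t) / (b - t) \<le> (\<phi> a - \<phi> t) / (a - t)"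
        using convex_on_slope_le(2)[OF conv ivl[of a] t(1), of b] ab
        by (simp add: minus_divide_left[symmetric] diff_divide_distrib)
      then show ?thesis by simp
    qed auto
  next
    fix b assume "b \<in> {0<..}" "b < t"
    then have "\<phi> b < \<phi> t"
      using strict_mono_onD[OF mono ivl t(1)] by auto
    then show "?q b \<le> 0"
      using \<open>b < t\<close> by (simp add: divide_nonpos_neg divide_nonpos_nonpos)
  qed
  moreover have "at t within ({..<t} \<inter> {0<..}) = at_left t"
    by (rule at_within_nhd[where S = "{0<..}"]) (use t(2) in auto)
  ultimately have "(?q \<longlongrightarrow> Sup (?q ` ({..<t} \<inter> {0<..}))) (at_left t)"
    by simp
  from tendsto_minus[OF this] show ?thesis by auto
qed

lemma left_derivative_cmult:
  fixes \<phi> :: "real \<Rightarrow> real"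
  assumes "((\<lambda>s. (\<phi> s - \<phi> t) / (s - t)) \<longlongrightarrow> l) (at_left t)"
  shows "left_derivative (\<lambda>s. c * \<phi> s) t = c * left_derivative \<phi> t"
proof -
  have "((\<lambda>s. (c * \<phi> s - c * \<phi> t) / (s - t)) \<longlongrightarrow> c * l) (at_left t)"
    using tendsto_mult_left[OF assms, of c] by (simp add: algebra_simps)
  then show ?thesis
    using assms by (simp add: left_derivative_def tendsto_Lim)
qed

section \<open>Matrices of full row rank\<close>

lemma norm_matrix_vector_le:
  fixes A :: "real ^ 'n ^ 'm"
  shows "norm (A *v x) \<le> (\<Sum>i\<in>UNIV. \<Sum>j\<in>UNIV. \<bar>A $ i $ j\<bar>) * norm x"
  using onorm[OF matrix_vector_mul_bounded_linear[of A], of x]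
    onorm_le_matrix_component_sum[of A] mult_right_mono norm_ge_zero order_trans by blast

text \<open>
  At \<open>x\<close> the transpose is injective, hence bounded below by some \<open>B > 0\<close>. A perturbation of
  operator norm at most \<open>B / 2\<close> costs at most half of this bound; the entrywise sum \<open>?S\<close>
  dominates the operator norm and is visibly continuous.
\<close>

lemma transpose_bounded_below_near_full_rank:
  fixes J :: "'a::metric_space \<Rightarrow> real ^ 'n ^ 'm"
  assumes cont: "isCont J x" and rk: "rank (J x) = CARD('m)"
  obtains \<alpha> e where "\<alpha> > 0" "e > 0"
    "\<And>y w. y \<in> ball x e \<Longrightarrow> norm w \<le> \<alpha> * norm (transpose (J y) *v w)"
proof -
  have "inj ((*v) (transpose (J x)))"
    using rk by (simp add: full_rank_injective[symmetric] rank_transpose)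
  then obtain B where B: "B > 0" "\<And>w. B * norm w \<le> norm (transpose (J x) *v w)"
    using linear_inj_bounded_below_pos[OF matrix_vector_mul_linear] by blast
  let ?S = "\<lambda>y. \<Sum>i\<in>UNIV. \<Sum>j\<in>UNIV. \<bar>(transpose (J x) - transpose (J y)) $ i $ j\<bar>"
  have "(?S \<longlongrightarrow> (\<Sum>i::'n\<in>UNIV. \<Sum>j::'m\<in>UNIV. 0)) (at x)"
    using cont unfolding isCont_def transpose_def
    by (intro tendsto_sum tendsto_rabs_zero) (auto intro!: tendsto_eq_intros)
  then have "\<forall>\<^sub>F y in at x. ?S y < B / 2"
    by (rule order_tendstoD) (use B in simp)
  then have "\<forall>\<^sub>F y in nhds x. ?S y < B / 2"
    using B by (simp add: eventually_nhds_conv_at)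
  then obtain e where e: "e > 0" "\<And>y. dist y x < e \<Longrightarrow> ?S y < B / 2"
    unfolding eventually_nhds_metric by blast
  have "norm w \<le> 2 / B * norm (transpose (J y) *v w)" if "y \<in> ball x e" for y w
  proof -
    have "norm ((transpose (J x) - transpose (J y)) *v w) \<le> ?S y * norm w"
      by (rule norm_matrix_vector_le)
    also have "\<dots> \<le> B / 2 * norm w"
      using e(2)[of y] that by (intro mult_right_mono) (auto simp: dist_commute)
    finally have "norm (transpose (J x) *v w) - norm (transpose (J y) *v w) \<le> B / 2 * norm w"
      using norm_triangle_ineq2[of "transpose (J x) *v w" "transpose (J y) *v w"]
      by (simp add: matrix_vector_mult_diff_rdistrib)
    then have "B / 2 * norm w \<le> norm (transpose (J y) *v w)"
      using B(2)[of w] by (simp add: field_simps)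
    then show ?thesis using B(1) by (simp add: field_simps)
  qed
  then show thesis using that[of "2 / B" e] B(1) e(1) by simp
qed

lemma continuous_on_Blinfun_matrix:
  fixes J :: "'a::metric_space \<Rightarrow> real ^ 'n ^ 'm"
  assumes "continuous_on UNIV J"
  shows "continuous_on UNIV (\<lambda>x. Blinfun ((*v) (J x)))"
proof (rule continuous_on_blinfun_componentwise)
  fix i :: "real ^ 'n"
  show "continuous_on UNIV (\<lambda>x. blinfun_apply (Blinfun ((*v) (J x))) i)"
    unfolding bounded_linear_Blinfun_apply[OF matrix_vector_mul_bounded_linear] matrix_vector_mult_def
    by (intro continuous_intros assms)
qed

section \<open>The KL property of a composition\<close>

lemma lsc_compose:
  assumes "lsc g" and F: "\<And>x. isCont F x"
  shows "lsc (\<lambda>x. g (F x))"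
  unfolding lsc_def le_Liminf_iff
proof (intro allI impI)
  fix x and c :: ereal assume c: "c < g (F x)"
  then have "\<forall>\<^sub>F y in at (F x). c < g y"
    using assms(1) unfolding lsc_def le_Liminf_iff by blast
  with c have "\<forall>\<^sub>F y in nhds (F x). c < g y"
    by (simp add: eventually_nhds_conv_at)
  from eventually_compose_filterlim[OF this F[unfolded continuous_at]]
  show "\<forall>\<^sub>F y in at x. c < g (F y)" .
qed

theorem theorem3p11:
  fixes f :: "real ^ 'n \<Rightarrow> ereal"
    and g :: "real ^ 'm \<Rightarrow> ereal"
    and F :: "real ^ 'n \<Rightarrow> real ^ 'm"
    and xbar :: "real ^ 'n"
    and \<epsilon>\<^sub>0 :: real and \<eta> :: ereal and \<phi> :: "real \<Rightarrow> real"
  assumes "\<And>x. f x = g (F x)"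
    and "proper g" and "lsc g"
    and "smooth_map F"
    and "xbar \<in> dom_subdiff f"
    and "\<epsilon>\<^sub>0 > 0"
    and "\<eta> > 0" and "\<phi> \<in> Phi \<eta>"
    and "gen_concave_KL g (F xbar) (ball (F xbar) \<epsilon>\<^sub>0) \<eta> \<phi>"
    and "rank (jacobian F (at xbar)) = CARD('m)"
  shows "\<exists>\<alpha> > 0. \<exists>\<epsilon>\<^sub>1 > 0.
    (\<forall>x \<in> ball xbar \<epsilon>\<^sub>1. \<forall>y \<in> UNIV - {0}.
       norm y \<le> \<alpha> * norm (transpose (jacobian F (at x)) *v y)) \<and>
    (\<exists>\<epsilon> \<in> {0 <.. min \<epsilon>\<^sub>0 \<epsilon>\<^sub>1}.
       (\<lambda>t. \<alpha> * \<phi> t) \<in> Phi \<eta> \<and>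
       gen_concave_KL f xbar (ball xbar \<epsilon>) \<eta> (\<lambda>t. \<alpha> * \<phi> t))"
proof -
  define J where "J x = jacobian F (at x)" for x
  define DF where "DF x = Blinfun ((*v) (J x))" for x
  have DF: "blinfun_apply (DF x) = (*v) (J x)" for x
    unfolding DF_def by (rule bounded_linear_Blinfun_apply[OF matrix_vector_mul_bounded_linear])
  have contJ: "continuous_on UNIV J"
    using assms(4) by (simp add: smooth_map_def J_def[abs_def])
  have der: "(F has_derivative blinfun_apply (DF x)) (at x)" for x
    using assms(4) by (simp add: smooth_map_def J_def DF jacobian_works)
  have contF: "isCont F x" for x
    using der has_derivative_continuous by blast
  have contDF: "continuous_on UNIV DF"
    unfolding DF_def by (rule continuous_on_Blinfun_matrix[OF contJ])
  have feq: "f = (\<lambda>x. g (F x))"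
    using assms(1) by blast
  have g: "g y \<noteq> -\<infinity>" for y
    using assms(2) by (simp add: proper_def)
  have "isCont J xbar"
    using contJ by (simp add: continuous_on_eq_continuous_at)
  then obtain \<alpha> \<epsilon>\<^sub>1 where \<alpha>: "\<alpha> > 0" and "\<epsilon>\<^sub>1 > 0"
    and le: "\<And>x y. x \<in> ball xbar \<epsilon>\<^sub>1 \<Longrightarrow> norm y \<le> \<alpha> * norm (transpose (J x) *v y)"
    using transpose_bounded_below_near_full_rank assms(10) unfolding J_def by metis
  obtain d where "d > 0" and d: "\<And>x. dist x xbar < d \<Longrightarrow> dist (F x) (F xbar) < \<epsilon>\<^sub>0"
    using contF[of xbar] \<open>\<epsilon>\<^sub>0 > 0\<close> unfolding continuous_at_eps_delta dist_norm by metis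
  define \<epsilon> where "\<epsilon> = min d (min \<epsilon>\<^sub>0 \<epsilon>\<^sub>1)"
  have \<epsilon>: "\<epsilon> > 0" "\<epsilon> \<le> d" "\<epsilon> \<le> min \<epsilon>\<^sub>0 \<epsilon>\<^sub>1"
    using \<open>d > 0\<close> \<open>\<epsilon>\<^sub>0 > 0\<close> \<open>\<epsilon>\<^sub>1 > 0\<close> by (auto simp: \<epsilon>_def)

  \<comment> \<open>The lower bound on \<open>J\<^sup>T\<close> serves twice: it makes \<open>J\<close> onto, as the chain rule requires, and
      it estimates \<open>v\<close> by \<open>u = J\<^sup>T v\<close>.\<close>
  have frechet: "\<exists>v \<in> frechet_subdiff g (F x). norm v \<le> \<alpha> * norm u"
    if x: "x \<in> ball xbar \<epsilon>\<^sub>1" and u: "u \<in> frechet_subdiff (\<lambda>x. g (F x)) x" for x u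
  proof -
    have "inj ((*v) (transpose (J x)))"
      unfolding linear_injective_0[OF matrix_vector_mul_linear]
    proof (intro allI impI)
      fix y assume "transpose (J x) *v y = 0"
      then show "y = 0" using le[OF x, of y] by simp
    qed
    then have "surj ((*v) (J x))"
      by (simp add: full_rank_injective[symmetric] full_rank_surjective[symmetric] rank_transpose)
    then obtain v where v: "v \<in> frechet_subdiff g (F x)" "\<And>z. u \<bullet> z = v \<bullet> (J x *v z)"
      using frechet_subdiff_chain_rule[OF g open_UNIV UNIV_I der contDF _ u] DF by auto
    have "u = transpose (J x) *v v"
      by (rule vector_eq_rdot[THEN iffD1]) (simp add: v(2) dot_lmul_matrix)
    then show ?thesis using le[OF x, of v] v(1) by blast
  qed
  have limiting: "\<exists>v \<in> limiting_subdiff g (F x). norm v \<le> \<alpha> * norm u"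
    if "x \<in> ball xbar \<epsilon>\<^sub>1" "u \<in> limiting_subdiff f x" for x u
    using limiting_subdiff_norm_bound[OF open_ball that(1) contF _ frechet] \<alpha> that(2)
    by (simp add: feq)

  have KL: "\<phi> \<in> Phi \<eta>" "concave_on (ivl \<eta>) \<phi>"
    "\<And>y. y \<in> ball (F xbar) \<epsilon>\<^sub>0 \<Longrightarrow> 0 < g y - g (F xbar) \<Longrightarrow> g y - g (F xbar) < \<eta> \<Longrightarrow>
      ereal (left_derivative \<phi> (real_of_ereal (g y - g (F xbar))))
        * edist_set 0 (limiting_subdiff g y) \<ge> 1"
    using assms(9) by (auto simp: gen_concave_KL_def)
  have Phi_scaled: "(\<lambda>t. \<alpha> * \<phi> t) \<in> Phi \<eta>"
    using KL(1) \<alpha> by (auto simp: Phi_def strict_mono_on_def intro!: continuous_intros)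
  have conc: "concave_on (ivl \<eta>) (\<lambda>t. \<alpha> * \<phi> t)"
    using KL(2) \<alpha> by (intro concave_on_cmul) auto
  have "f xbar < \<infinity>"
    using assms(5) by (auto simp: dom_subdiff_def limiting_subdiff_def edom_def)
  then have properf: "proper f"
    using g by (auto simp: proper_def feq)
  have lscf: "lsc f"
    unfolding feq by (rule lsc_compose[OF assms(3) contF])
  have main: "ereal (left_derivative (\<lambda>t. \<alpha> * \<phi> t) (real_of_ereal (f x - f xbar)))
      * edist_set 0 (limiting_subdiff f x) \<ge> 1"
    if x: "x \<in> ball xbar \<epsilon>" and pos: "0 < f x - f xbar" and less: "f x - f xbar < \<eta>" for x
  proof -
    define t where "t = real_of_ereal (f x - f xbar)"
    have t: "f x - f xbar = ereal t"
      unfolding t_def using pos less by (cases "f x - f xbar") auto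
    then have "t \<in> ivl \<eta>" "t > 0"
      using pos less by (auto simp: ivl_def)
    then obtain l where "((\<lambda>s. (\<phi> s - \<phi> t) / (s - t)) \<longlongrightarrow> l) (at_left t)"
      using left_derivative_exists[OF KL(2)] KL(1) by (auto simp: Phi_def)
    note ld = left_derivative_cmult[OF this, of \<alpha>]
    let ?Dg = "edist_set 0 (limiting_subdiff g (F x))" and ?Df = "edist_set 0 (limiting_subdiff f x)"
    have "F x \<in> ball (F xbar) \<epsilon>\<^sub>0"
      using d[of x] x \<epsilon>(2) by (simp add: dist_commute)
    then have ge: "1 \<le> ereal (left_derivative \<phi> t) * ?Dg"
      using KL(3)[of "F x"] pos less by (simp add: t_def feq)
    have Dg: "0 \<le> ?Dg"
      unfolding edist_set_def by (rule INF_greatest) simp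
    \<comment> \<open>Positivity is what makes the product with an infinite distance \<open>\<infinity>\<close>, hence what settles
        points where \<open>f\<close> has no limiting subgradient.\<close>
    have pos': "left_derivative \<phi> t > 0"
    proof (rule ccontr)
      assume "\<not> ?thesis"
      then have "ereal (left_derivative \<phi> t) * ?Dg \<le> 0 * ?Dg"
        using Dg by (intro ereal_mult_right_mono) auto
      from order_trans[OF ge this] show False by simp
    qed
    have "?Dg \<le> ereal \<alpha> * ?Df"
      using edist_set_le_cmult[OF \<alpha> limiting] x \<epsilon>(3) by simp
    then have "ereal (left_derivative \<phi> t) * ?Dg \<le> ereal (left_derivative \<phi> t) * (ereal \<alpha> * ?Df)"
      using pos' by (intro ereal_mult_left_mono) auto
    also have "\<dots> = ereal (left_derivative (\<lambda>t. \<alpha> * \<phi> t) t) * ?Df"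
      by (simp add: ld mult_ac flip: times_ereal.simps(1))
    finally show ?thesis using ge unfolding t_def by order
  qed
  have "gen_concave_KL f xbar (ball xbar \<epsilon>) \<eta> (\<lambda>t. \<alpha> * \<phi> t)"
    unfolding gen_concave_KL_def
    using properf lscf assms(5,7) \<epsilon>(1) Phi_scaled conc main by (auto simp: interior_open)
  then show ?thesis
    using \<alpha> \<open>\<epsilon>\<^sub>1 > 0\<close> le \<epsilon> Phi_scaled unfolding J_def
    by (intro exI[of _ \<alpha>] exI[of _ \<epsilon>\<^sub>1] conjI bexI[of _ \<epsilon>]) auto
qed

end
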